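(* Let $p$ be an odd prime, let $m\ge 2$ be an even integer, let $q=p^m$, and let $D=\{x\in \mathrm{GF}(q)^*: \mathrm{Tr}(x^2)=0\}$. Let $\bar D=\{d_1,\ldots,d_n\}$ be such that $D=\{ab: a\in \mathrm{GF}(p)^*,\ b\in\bar D\}$ and $d_i/d_j\notin \mathrm{GF}(p)^*$ for every pair of distinct elements $d_i,d_j$ of $\bar D$. Put $\varepsilon=(-1)^{\left(\frac{p-1}{2}\right)^2\frac{m}{2}}$. Then the code $$\mathcal{C}_{\bar D}=\{(\mathrm{Tr}(xd_1),\ldots,\mathrm{Tr}(xd_n)): x\in \mathrm{GF}(q)\}$$ over $\mathrm{GF}(p)$ has length $n=\frac{p^{m-1}-1}{p-1}-\varepsilon p^{\frac{m-2}{2}}$ and dimension $m$, and its weight distribution is - $A_0=1$; - $A_w=p^{m-1}-\varepsilon(p-1)p^{\frac{m-2}{2}}-1$ for $w=p^{m-2}$; - $A_w=(p-1)\left(p^{m-1}+\varepsilon p^{\frac{m-2}{2}}\right)$ for $w=p^{m-2}-\varepsilon p^{\frac{m-2}{2}}$; and $A_w=0$ for all other weights $w$.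
   Context: $\mathrm{GF}(q)$ is the finite field with $q$ elements, $\mathrm{GF}(q)^*$ its multiplicative group, and $\mathrm{Tr}$ is the trace function from $\mathrm{GF}(q)$ onto $\mathrm{GF}(p)$. The set $D$ is closed under multiplication by $\mathrm{GF}(p)^*$, and $\bar D$ is a set of representatives of $D$ modulo this action, with elements listed in any fixed order. A linear code of length $n$ and dimension $k$ over $\mathrm{GF}(p)$ is a $k$-dimensional subspace of $\mathrm{GF}(p)^n$; $A_w$ denotes the number of codewords of Hamming weight $w$ in the code.
   Formalization: The formal theorem assumes n ≥ 1, i.e. D is nonempty; this excludes exactly m = 2 with p ≡ 1 (mod 4), where D is empty, the code has dimension 0 instead of m, and the third formula would give A_0 = p^2 − 1, so the claim as printed is false there. *)

theory Defs
  imports "HOL-Analysis.Analysis" "Berlekamp_Zassenhaus.Finite_Field"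
begin

text \<open>
  GF(p) is the type \<open>'p mod_ring\<close> with \<open>'p :: prime_card\<close>, and GF(q) is any finite field
  type \<open>'q\<close> with \<open>q = p ^ m\<close> elements.
\<close>

definition gf_embed :: "'p::prime_card mod_ring \<Rightarrow> 'q::field" where
  "gf_embed c = of_int (to_int_mod_ring c)"

text \<open>
  The trace of the extension of degree \<open>m\<close>. It lies in the prime field, so that \<open>inv_into\<close> is harmless,
  whenever \<open>'q\<close> has \<open>CARD('p) ^ m\<close> elements; see \<open>gf_embed_gf_trace\<close> below.
\<close>

definition gf_trace :: "nat \<Rightarrow> 'q::finite_field \<Rightarrow> 'p::prime_card mod_ring" where
  "gf_trace m x = inv_into UNIV gf_embed (\<Sum>i<m. x ^ (CARD('p) ^ i))"

lemma CHAR_gf: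
  assumes "CARD('q::finite_field) = CARD('p::prime_card) ^ m"
  shows "CHAR('q) = CARD('p)"
proof -
  have pr: "prime CHAR('q)"
    using prime_CHAR_semidom[where ?'a = 'q] finite_imp_CHAR_pos[where ?'a = 'q] by simp
  have "CHAR('q) dvd CARD('p) ^ m"
    using CHAR_dvd_CARD[where ?'a = 'q] assms by simp
  then have "CHAR('q) dvd CARD('p)"
    using pr prime_dvd_power by blast
  then show ?thesis
    using pr prime_card[where ?'a = 'p] primes_dvd_imp_eq by blast
qed

lemma inj_gf_embed:
  assumes "CARD('q::finite_field) = CARD('p::prime_card) ^ m"
  shows "inj (gf_embed :: 'p mod_ring \<Rightarrow> 'q)"
proof (rule injI)
  fix a b :: "'p mod_ring"
  let ?a = "to_int_mod_ring a" and ?b = "to_int_mod_ring b"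
  assume "(gf_embed a :: 'q) = gf_embed b"
  then have "of_int (?a - ?b) = (0::'q)"
    by (simp add: gf_embed_def)
  then have "int CARD('p) dvd ?a - ?b"
    using of_int_eq_0_iff_char_dvd[where ?'a = 'q] CHAR_gf[OF assms] by metis
  moreover have "?a \<in> {0..<int CARD('p)}" "?b \<in> {0..<int CARD('p)}"
    using range_to_int_mod_ring[where ?'a = 'p] by blast+
  ultimately have "?a = ?b"
    using mod_eq_dvd_iff[of ?a "int CARD('p)" ?b] by simp
  then show "a = b"
    by (metis of_int_mod_ring_to_int_mod_ring)
qed

lemma gf_embed_power_card:
  assumes "CARD('q::finite_field) = CARD('p::prime_card) ^ m"
  shows "(gf_embed (a :: 'p mod_ring) :: 'q) ^ CARD('p) = gf_embed a"
proof -
  let ?p = "CARD('p)"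
  have pr: "prime CHAR('q)"
    using CHAR_gf[OF assms] prime_card[where ?'a = 'p] by simp
  have *: "(of_nat k :: 'q) ^ ?p = of_nat k" for k
  proof (induction k)
    case (Suc k)
    then show ?case
      using freshmans_dream[OF pr, of ?p 1 "of_nat k"] CHAR_gf[OF assms] by simp
  qed (simp add: prime_gt_0_nat prime_card)
  have "0 \<le> to_int_mod_ring a"
    using range_to_int_mod_ring[where ?'a = 'p] by fastforce
  then obtain k where "to_int_mod_ring a = int k"
    using zero_le_imp_eq_int by blast
  then show ?thesis
    using * by (simp add: gf_embed_def)
qed

lemma range_gf_embed:
  assumes "CARD('q::finite_field) = CARD('p::prime_card) ^ m"
  shows "range (gf_embed :: 'p mod_ring \<Rightarrow> 'q) = {y. y ^ CARD('p) = y}"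
proof -
  let ?p = "CARD('p)" and ?R = "range (gf_embed :: 'p mod_ring \<Rightarrow> 'q)"
  let ?f = "Polynomial.monom 1 ?p - Polynomial.monom 1 1 :: 'q poly"
  have p1: "?p > 1"
    using prime_card[where ?'a = 'p] prime_gt_1_nat by blast
  have deg: "degree ?f \<le> ?p"
    using p1 by (intro degree_diff_le) (auto simp: degree_monom_eq)
  have "Polynomial.coeff ?f ?p = 1"
    using p1 by simp
  then have nz: "?f \<noteq> 0"
    by (metis Polynomial.coeff_0 zero_neq_one)
  have roots: "{y. poly ?f y = 0} = {y. y ^ ?p = y}"
    by (auto simp: poly_monom)
  have "card {y::'q. y ^ ?p = y} \<le> ?p"
    using card_poly_roots_bound[OF nz] deg roots by simp
  also have "?p = card ?R"
    using card_image[OF inj_gf_embed[OF assms]] by simp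
  finally have "card {y::'q. y ^ ?p = y} \<le> card ?R" .
  moreover have "?R \<subseteq> {y. y ^ ?p = y}"
    using gf_embed_power_card[OF assms] by auto
  ultimately show ?thesis
    by (intro card_seteq) auto
qed

lemma gf_embed_gf_trace:
  fixes x :: "'q::finite_field"
  assumes "CARD('q) = CARD('p::prime_card) ^ m"
  shows "gf_embed (gf_trace m x :: 'p mod_ring) = (\<Sum>i<m. x ^ (CARD('p) ^ i))"
proof -
  let ?p = "CARD('p)" and ?s = "\<Sum>i<m. x ^ (CARD('p) ^ i)"
  have pr: "prime CHAR('q)"
    using CHAR_gf[OF assms] prime_card[where ?'a = 'p] by simp
  have xq: "x ^ (?p ^ m) = x"
    using finite_field_power_card_eq_same[of x] assms by simp
  have "?s ^ ?p = (\<Sum>i<m. x ^ (?p ^ Suc i))"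
    using freshmans_dream_sum[OF pr, of ?p "\<lambda>i. x ^ (?p ^ i)" "{..<m}"] CHAR_gf[OF assms]
    by (simp add: mult.commute flip: power_mult)
  also have "\<dots> = ?s"
    using sum.lessThan_Suc_shift[of "\<lambda>i. x ^ (?p ^ i)" m]
      sum.lessThan_Suc[of "\<lambda>i. x ^ (?p ^ i)" m] xq by (simp add: add.commute)
  finally have "?s \<in> range (gf_embed :: 'p mod_ring \<Rightarrow> 'q)"
    using range_gf_embed[OF assms] by simp
  then show ?thesis
    by (simp add: gf_trace_def f_inv_into_f)
qed

text \<open>
  A vector of length \<open>n\<close> has type \<open>_ ^ 'n\<close> with \<open>CARD('n) = n\<close>. Index types are nonempty, so
  only codes of positive length are considered.
\<close>

definition trace_code :: "nat \<Rightarrow> ('n::finite \<Rightarrow> 'q::finite_field) \<Rightarrow> ('p::prime_card mod_ring ^ 'n) set"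
  where "trace_code m d = {(\<chi> i. gf_trace m (x * d i)) | x. True}"

definition linear_code :: "('k::field ^ 'n::finite) set \<Rightarrow> nat \<Rightarrow> bool" where
  "linear_code C k \<longleftrightarrow> vec.subspace C \<and> vec.dim C = k"

definition hamming_weight :: "'k::zero ^ 'n::finite \<Rightarrow> nat" where
  "hamming_weight v = card {i. v $ i \<noteq> 0}"

definition weight_count :: "('k::zero ^ 'n::finite) set \<Rightarrow> nat \<Rightarrow> nat" where
  "weight_count C w = card {v \<in> C. hamming_weight v = w}"

end

theory Submission
  imports Defs
begin

text \<open>
  Write \<open>T x = Tr(x\<^sup>2)\<close>, \<open>m = 2k\<close> and \<open>Q = p ^ k\<close>. No Gauss sum is needed to count the zeros of \<open>T\<close>. Elements
  \<open>a\<close> of \<open>GF(Q)\<close> are squares in \<open>GF(q)\<close>, so \<open>x \<mapsto> Tr(a x\<^sup>2)\<close> has as many zeros as \<open>T\<close> when \<open>a \<noteq> 0\<close>.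
  On the other hand, \<open>Tr(a x\<^sup>2)\<close> is the trace of \<open>a (x ^ 2 + x ^ (2 Q))\<close> from \<open>GF(Q)\<close> to \<open>GF(p)\<close>; for fixed \<open>x\<close> the number
  of suitable \<open>a\<close> only depends on whether \<open>x ^ 2 + x ^ (2 Q)\<close> vanishes. This happens for \<open>2(Q - 1)\<close> or for no
  nonzero \<open>x\<close>, according as \<open>-1\<close> is a nonsquare or a square in \<open>GF(Q)\<close>, which is where \<open>\<epsilon>\<close> comes from.

  The weight of the codeword of \<open>x\<close> is the number of zeros \<open>y\<close> of \<open>T\<close> with \<open>Tr(xy) \<noteq> 0\<close>, divided by
  \<open>p - 1\<close>. If \<open>T x = 0\<close>, then \<open>T(y + c x) = T y + 2c Tr(xy)\<close>, so \<open>T\<close> is equidistributed on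
  \<open>{y. Tr(xy) \<noteq> 0}\<close>. If \<open>t = T x \<noteq> 0\<close>, the same argument applies to the form \<open>T y - t a\<^sup>2\<close> in one more
  variable, for which \<open>(x, 1)\<close> is isotropic; it has \<open>q\<close> zeros because all nonzero values of \<open>T\<close> are
  taken equally often.
\<close>

section \<open>Exact counts from bounds on numbers of roots\<close>

lemma card_eq_sum_fibres:
  assumes "finite A" "finite B" "f ` A \<subseteq> B"
  shows "card A = (\<Sum>b\<in>B. card {a \<in> A. f a = b})"
  using sum.group[OF assms, of "\<lambda>_. 1 :: nat"] by simp

text \<open>At most \<open>s\<close> fibres of size at most \<open>r\<close> share
  \<open>r * s\<close> elements, so none can fall short. This turns upper bounds given by polynomial
  degrees into exact counts.\<close>

lemma card_fibre_eqI:
  assumes "finite A" "finite B" "f ` A \<subseteq> B"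
    and card: "card A = r * s" "card B \<le> s"
    and le: "\<And>b. b \<in> B \<Longrightarrow> card {a \<in> A. f a = b} \<le> r"
    and "b \<in> B"
  shows "card {a \<in> A. f a = b} = r"
proof (rule ccontr)
  assume "card {a \<in> A. f a = b} \<noteq> r"
  then have "(\<Sum>b\<in>B. card {a \<in> A. f a = b}) < (\<Sum>b\<in>B. r)"
    using assms le by (intro sum_strict_mono_ex1) (auto intro!: bexI[of _ b] simp: order_less_le)
  also have "\<dots> \<le> r * s"
    using card by (simp add: mult.commute)
  finally show False
    using card card_eq_sum_fibres[OF assms(1-3)] by simp
qed

lemma card_power_eq_le:
  fixes c :: "'a::idom"
  assumes "0 < n"
  shows "card {x. x ^ n = c} \<le> n"
proof -
  let ?f = "Polynomial.monom 1 n - [:c:]"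
  have "Polynomial.coeff ?f n = 1"
    using assms by (cases n) (auto simp: coeff_pCons)
  then have nz: "?f \<noteq> 0"
    by (metis Polynomial.coeff_0 zero_neq_one)
  have "degree ?f \<le> n"
    by (intro degree_diff_le) (auto simp: degree_monom_le)
  moreover have "{x. poly ?f x = 0} = {x. x ^ n = c}"
    by (auto simp: poly_monom)
  ultimately show ?thesis
    using card_poly_roots_bound[OF nz] by simp
qed

text \<open>Since \<open>x ^ (r * s) = 1\<close> on units, \<open>x \<mapsto> x ^ r\<close> sends
  them into the roots of \<open>y ^ s = 1\<close>. Degrees bound the fibres by \<open>r\<close> and
  the target by \<open>s\<close>, so \<open>card_fibre_eqI\<close> applies.\<close>

lemma card_power_eq:
  fixes c :: "'a::finite_field"
  assumes rs: "CARD('a) - 1 = r * s" and c: "c ^ s = 1"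
  shows "card {x. x ^ r = c} = r"
proof -
  have "CARD('a) > 1"
    using card_mono[of UNIV "{0, 1 :: 'a}"] by simp
  then have pos: "0 < r" "0 < s"
    using rs by (auto intro: ccontr)
  have one: "x ^ (r * s) = 1" if "x \<noteq> 0" for x :: 'a
  proof -
    have "CARD('a) = Suc (r * s)"
      using rs \<open>CARD('a) > 1\<close> by simp
    then have "x * x ^ (r * s) = x"
      using finite_field_power_card_eq_same[of x] by simp
    then show ?thesis
      using that by simp
  qed
  have "card {x \<in> UNIV - {0}. x ^ r = c} = r"
  proof (rule card_fibre_eqI[where B = "{y. y ^ s = 1}" and s = s])
    show "(\<lambda>x. x ^ r) ` (UNIV - {0}) \<subseteq> {y::'a. y ^ s = 1}"
      using one by (auto simp: power_mult)
    show "card (UNIV - {0::'a}) = r * s"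
      using rs by (simp add: card_Diff_singleton)
    show "card {x \<in> UNIV - {0}. x ^ r = b} \<le> r" for b :: 'a
      using card_power_eq_le[OF pos(1), of b] card_mono[of "{x. x ^ r = b}" "{x \<in> UNIV - {0}. x ^ r = b}"]
      by force
  qed (use c pos card_power_eq_le in auto)
  moreover have "{x \<in> UNIV - {0}. x ^ r = c} = {x. x ^ r = c}"
    using c pos by (auto simp: power_0_left)
  ultimately show ?thesis by simp
qed

text \<open>GF(p ^ k) appears as the fixed points of \<open>u \<mapsto> u ^ (p ^ k)\<close> inside
  \<open>'a\<close>. Its trace is a polynomial of degree \<open>p ^ (k - 1)\<close> with at most
  \<open>p\<close> values, so all fibres are full. Applied both to GF(q) and to GF(Q).\<close>

lemma card_trace_fibre:
  fixes c :: "'a::finite_field"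
  assumes pr: "prime p" "CHAR('a) = p" and k: "0 < k"
    and card: "card {u::'a. u ^ (p ^ k) = u} = p ^ k" and c: "c ^ p = c"
  shows "card {u. u ^ (p ^ k) = u \<and> (\<Sum>i<k. u ^ (p ^ i)) = c} = p ^ (k - 1)"
proof -
  let ?K = "{u::'a. u ^ (p ^ k) = u}" and ?s = "\<lambda>u::'a. \<Sum>i<k. u ^ (p ^ i)"
  have p1: "p > 1"
    using pr prime_gt_1_nat by blast
  have le: "card {u. ?s u = b} \<le> p ^ (k - 1)" for b :: 'a
  proof -
    let ?f = "(\<Sum>i<k. Polynomial.monom 1 (p ^ i)) - [:b:]"
    \<comment> \<open>The exponents \<open>p ^ i\<close> are distinct and even \<open>p ^ 0\<close>
      exceeds the degree of the constant \<open>b\<close>, so only \<open>i = k - 1\<close>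
      contributes.\<close>
    have "Polynomial.coeff ?f (p ^ (k - 1)) = (\<Sum>i<k. if i = k - 1 then 1 else 0)"
      using p1 by (auto simp: Polynomial.coeff_sum coeff_pCons split: nat.splits intro!: sum.cong)
    also have "\<dots> = 1"
      using k by (subst sum.delta) auto
    finally have nz: "?f \<noteq> 0"
      by (metis Polynomial.coeff_0 zero_neq_one)
    have "degree ?f \<le> p ^ (k - 1)"
      using p1 by (intro degree_diff_le degree_sum_le)
        (auto intro!: order.trans[OF degree_monom_le] power_increasing)
    moreover have "{u. poly ?f u = 0} = {u. ?s u = b}"
      by (auto simp: poly_monom poly_sum)
    ultimately show ?thesis
      using card_poly_roots_bound[OF nz] by simp
  qed
  have fixed: "?s u ^ p = ?s u" if "u \<in> ?K" for u
  proof -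
    have "?s u ^ p = (\<Sum>i<k. (u ^ (p ^ i)) ^ p)"
      using freshmans_dream_sum[of p "\<lambda>i. u ^ (p ^ i)" "{..<k}"] pr by blast
    also have "\<dots> = (\<Sum>i<k. u ^ (p ^ Suc i))"
      by (simp add: mult.commute flip: power_mult)
    also have "\<dots> = ?s u"
      using sum.lessThan_Suc_shift[of "\<lambda>i. u ^ (p ^ i)" k]
        sum.lessThan_Suc[of "\<lambda>i. u ^ (p ^ i)" k] that by (simp add: add.commute)
    finally show ?thesis .
  qed
  have "card {y::'a. y ^ p = y} \<le> p"
  proof -
    let ?f = "Polynomial.monom 1 p - Polynomial.monom 1 1 :: 'a poly"
    have "Polynomial.coeff ?f p = 1"
      using p1 by simp
    then have nz: "?f \<noteq> 0"
      by (metis Polynomial.coeff_0 zero_neq_one)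
    have "degree ?f \<le> p"
      using p1 by (intro degree_diff_le) (auto simp: degree_monom_eq)
    moreover have "{y. poly ?f y = 0} = {y. y ^ p = y}"
      by (auto simp: poly_monom)
    ultimately show ?thesis
      using card_poly_roots_bound[OF nz] by simp
  qed
  moreover have "card ?K = p ^ (k - 1) * p"
    using card k by (cases k) (auto simp: mult.commute)
  moreover have "card {u \<in> ?K. ?s u = b} \<le> p ^ (k - 1)" for b
    using le[of b] card_mono[of "{u. ?s u = b}" "{u \<in> ?K. ?s u = b}"] by force
  ultimately have "card {u \<in> ?K. ?s u = c} = p ^ (k - 1)"
    using fixed c by (intro card_fibre_eqI[where B = "{y. y ^ p = y}" and s = p]) auto
  then show ?thesis by simp
qed

section \<open>Cardinality and dimension of subspaces\<close>

lemma card_span_eq: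
  fixes B :: "('a::{field,finite} ^ 'n::finite) set"
  assumes "finite B" "vec.independent B"
  shows "card (vec.span B) = CARD('a) ^ card B"
  using assms
proof (induction B)
  case (insert b B)
  have ind: "vec.independent B" "b \<notin> vec.span B"
    using insert by (auto simp: vec.independent_insert)
  let ?f = "\<lambda>(c, v). c *s b + v"
  have "inj_on ?f (UNIV \<times> vec.span B)"
  proof (rule inj_onI, clarify)
    fix c c' v v'
    assume v: "v \<in> vec.span B" "v' \<in> vec.span B" and eq: "c *s b + v = c' *s b + v'"
    have "(c - c') *s b = v' - v"
      using eq by (simp add: algebra_simps vec.scale_left_diff_distrib)
    then have "(c - c') *s b \<in> vec.span B"
      using v vec.span_diff by metis
    then have "(1 / (c - c')) *s ((c - c') *s b) \<in> vec.span B"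
      by (rule vec.span_scale)
    then have "c = c'"
      using ind vec.scale_scale[of "1 / (c - c')" "c - c'" b] by (cases "c = c'") auto
    then show "c = c' \<and> v = v'"
      using eq by simp
  qed
  moreover have "?f ` (UNIV \<times> vec.span B) = vec.span (insert b B)"
  proof safe
    fix c v assume "v \<in> vec.span B"
    then show "c *s b + v \<in> vec.span (insert b B)"
      by (auto simp: vec.span_breakdown_eq intro!: exI[of _ c])
  next
    fix w assume "w \<in> vec.span (insert b B)"
    then obtain c where "w - c *s b \<in> vec.span B"
      by (auto simp: vec.span_breakdown_eq)
    then show "w \<in> ?f ` (UNIV \<times> vec.span B)"
      by (intro image_eqI[of _ _ "(c, w - c *s b)"]) auto
  qed
  ultimately have "card (vec.span (insert b B)) = card (UNIV \<times> vec.span B :: ('a \<times> _) set)"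
    by (metis card_image)
  then show ?case
    using insert ind by (simp add: card_cartesian_product)
qed simp

text \<open>Lets the dimension of the code be read off from its number of words.\<close>

lemma card_subspace_eq:
  fixes S :: "('a::{field,finite} ^ 'n::finite) set"
  assumes "vec.subspace S"
  shows "card S = CARD('a) ^ vec.dim S"
proof -
  obtain B where B: "B \<subseteq> S" "vec.independent B" "S \<subseteq> vec.span B" "card B = vec.dim S"
    using vec.basis_exists by blast
  then have "vec.span B = S"
    using vec.span_subspace assms by blast
  then show ?thesis
    using card_span_eq[of B] B vec.finiteI_independent by metis
qed

section \<open>Shifts along an isotropic vector\<close>

text \<open>Think of \<open>\<tau>\<close> as a quadratic form, \<open>\<sigma> c\<close> as
  translation by \<open>c\<close> times an isotropic vector and \<open>\<beta>\<close> as the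
  pairing with that vector. Where \<open>\<beta> s \<noteq> 0\<close>, \<open>\<tau>\<close> is
  affine in \<open>c\<close> with nonzero slope, so all its values are equally frequent. The type
  \<open>'s\<close> is left open to admit both GF(q) and its product with GF(p).\<close>

lemma card_isotropic_shift:
  fixes \<tau> \<beta> :: "'s::finite \<Rightarrow> 'p::prime_card mod_ring" and \<sigma> :: "'p mod_ring \<Rightarrow> 's \<Rightarrow> 's"
  assumes odd: "odd CARD('p)"
    and inv: "\<And>c s. \<sigma> (- c) (\<sigma> c s) = s"
    and \<beta>: "\<And>c s. \<beta> (\<sigma> c s) = \<beta> s"
    and \<tau>: "\<And>c s. \<tau> (\<sigma> c s) = \<tau> s + 2 * c * \<beta> s"
  shows "CARD('p) * card {s. \<beta> s \<noteq> 0 \<and> \<tau> s = 0} = card {s. \<beta> s \<noteq> 0}"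
proof -
  have two: "(2 :: 'p mod_ring) \<noteq> 0"
  proof
    assume "(2 :: 'p mod_ring) = 0"
    then have "CARD('p) dvd 2"
      using of_nat_0_mod_ring_dvd[of 2, where ?'a = 'p] by simp
    then show False
      using odd nontriv[where ?'a = 'p] by (auto dest!: dvd_imp_le simp: le_Suc_eq numeral_2_eq_2)
  qed
  have eq: "card {s \<in> {s. \<beta> s \<noteq> 0}. \<tau> s = b} = card {s. \<beta> s \<noteq> 0 \<and> \<tau> s = 0}" for b
  proof (rule bij_betw_same_card)
    \<comment> \<open>The parameter solves \<open>\<tau> s + 2 * c * \<beta> s = 0\<close> for
      \<open>\<tau> s = b\<close>. As the shift preserves \<open>\<beta>\<close>, the inverse shift
      can be computed from the image.\<close>
    show "bij_betw (\<lambda>s. \<sigma> (- (b / (2 * \<beta> s))) s)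
            {s \<in> {s. \<beta> s \<noteq> 0}. \<tau> s = b} {s. \<beta> s \<noteq> 0 \<and> \<tau> s = 0}"
    proof (rule bij_betw_byWitness[where f' = "\<lambda>s. \<sigma> (b / (2 * \<beta> s)) s"])
      have "\<sigma> c (\<sigma> (- c) s) = s" for c s
        using inv[of "- c" s] by simp
      then show "\<forall>s\<in>{s. \<beta> s \<noteq> 0 \<and> \<tau> s = 0}. \<sigma> (- (b / (2 * \<beta> (\<sigma> (b / (2 * \<beta> s)) s)))) (\<sigma> (b / (2 * \<beta> s)) s) = s"
        and "\<forall>s\<in>{s \<in> {s. \<beta> s \<noteq> 0}. \<tau> s = b}. \<sigma> (b / (2 * \<beta> (\<sigma> (- (b / (2 * \<beta> s))) s))) (\<sigma> (- (b / (2 * \<beta> s))) s) = s"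
        by (simp_all add: \<beta> inv)
    qed (use two in \<open>auto simp: \<beta> \<tau> field_simps\<close>)
  qed
  have "card {s. \<beta> s \<noteq> 0} = (\<Sum>b::'p mod_ring\<in>UNIV. card {s. \<beta> s \<noteq> 0 \<and> \<tau> s = 0})"
    using card_eq_sum_fibres[of "{s. \<beta> s \<noteq> 0}" UNIV \<tau>] eq by (simp only: finite_code subset_UNIV)
  then show ?thesis by simp
qed

section \<open>GF(q) over GF(p): embedding and trace\<close>

text \<open>Tying \<open>tr\<close> and \<open>emb\<close> by equations to \<open>gf_trace m\<close>
  and \<open>gf_embed\<close> fixes their types once and for all.\<close>

locale gf_extension =
  fixes tr :: "'q::finite_field \<Rightarrow> 'p::prime_card mod_ring"
    and emb :: "'p mod_ring \<Rightarrow> 'q"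
    and p m k :: nat
  assumes tr_def: "tr = gf_trace m" and emb_def: "emb = gf_embed"
    and p_def: "p = CARD('p)" and odd_p: "odd p"
    and card_q: "CARD('q) = p ^ m" and m_eq: "m = 2 * k" and k_pos: "0 < k"
begin

lemma card_q': "CARD('q) = CARD('p) ^ m"
  using card_q p_def by simp

lemma prime_p: "prime p"
  using prime_card[where ?'a = 'p] p_def by simp

lemma p_ge: "3 \<le> p"
  using prime_ge_2_nat[OF prime_p] odd_p by (cases "p = 2") auto

lemma p_pos: "0 < p"
  using p_ge by simp

lemma CHAR_q: "CHAR('q) = p"
  using CHAR_gf[OF card_q'] p_def by simp

lemma power_card: "(x :: 'q) ^ (p ^ m) = x"
  using finite_field_power_card_eq_same[of x] card_q by simp

lemma of_int_mod: "(of_int (a mod int p) :: 'q) = of_int a"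
proof -
  have "(of_int a :: 'q) = of_int (a mod int p) + of_int (int p) * of_int (a div int p)"
    by (metis mod_mult_div_eq of_int_add of_int_mult)
  then show ?thesis
    using of_nat_CHAR[where ?'a = 'q] CHAR_q by simp
qed

lemma emb_add: "emb (a + b) = emb a + emb b"
  by (simp add: emb_def gf_embed_def to_int_mod_ring_add of_int_mod flip: p_def)

lemma emb_mult: "emb (a * b) = emb a * emb b"
  by (simp add: emb_def gf_embed_def to_int_mod_ring_mult of_int_mod flip: p_def)

lemma emb_0: "emb 0 = 0"
  by (simp add: emb_def gf_embed_def)

lemma emb_eq_iff: "emb a = emb b \<longleftrightarrow> a = b"
  using inj_gf_embed[OF card_q'] unfolding emb_def by (auto dest: injD)

lemma emb_eq_0_iff: "emb a = 0 \<longleftrightarrow> a = 0"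
  using emb_eq_iff[of a 0] emb_0 by simp

lemma emb_power: "emb a ^ (p ^ i) = emb a"
proof (induction i)
  case (Suc i)
  have "emb a ^ (p ^ Suc i) = (emb a ^ (p ^ i)) ^ p"
    by (simp add: mult.commute flip: power_mult)
  then show ?case
    using Suc gf_embed_power_card[OF card_q', of a] p_def emb_def by simp
qed simp

lemma frobenius_add: "(x + y :: 'q) ^ (p ^ i) = x ^ (p ^ i) + y ^ (p ^ i)"
  using freshmans_dream'[of "p ^ i" i x y] prime_p CHAR_q by blast

lemma emb_tr: "emb (tr x) = (\<Sum>i<m. x ^ (p ^ i))"
  using gf_embed_gf_trace[OF card_q', of x] by (simp add: emb_def tr_def p_def)

lemma tr_add: "tr (x + y) = tr x + tr y"
proof -
  have "emb (tr (x + y)) = emb (tr x + tr y)"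
    by (simp add: emb_tr emb_add frobenius_add sum.distrib)
  then show ?thesis by (simp add: emb_eq_iff)
qed

lemma tr_scale: "tr (emb c * x) = c * tr x"
proof -
  have "emb (tr (emb c * x)) = emb (c * tr x)"
    by (simp add: emb_tr emb_mult power_mult_distrib emb_power sum_distrib_left)
  then show ?thesis by (simp add: emb_eq_iff)
qed

lemma tr_0: "tr 0 = 0"
  using tr_scale[of 0 0] by simp

lemma card_tr_eq: "card {x. tr x = c} = p ^ (m - 1)"
proof -
  have "card {u::'q. u ^ (p ^ m) = u} = p ^ m"
    using power_card card_q by simp
  then have "card {u::'q. u ^ (p ^ m) = u \<and> (\<Sum>i<m. u ^ (p ^ i)) = emb c} = p ^ (m - 1)"
    using prime_p CHAR_q m_eq k_pos emb_power[of c 1] by (intro card_trace_fibre) auto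
  then show ?thesis
    using power_card by (simp add: emb_eq_iff flip: emb_tr)
qed

lemma card_tr_mult_eq:
  assumes "x \<noteq> 0"
  shows "card {y. tr (x * y) = c} = p ^ (m - 1)"
proof -
  have "bij_betw (\<lambda>y. x * y) {y. tr (x * y) = c} {x. tr x = c}"
    using assms by (intro bij_betw_byWitness[where f' = "\<lambda>y. y / x"]) auto
  then show ?thesis
    using card_tr_eq bij_betw_same_card by metis
qed

section \<open>The intermediate field GF(Q) as the fixed points of
  \<open>x \<mapsto> x ^ Q\<close>\<close>

abbreviation "Q \<equiv> p ^ k"

lemma Q_ge: "3 \<le> Q"
  using p_ge self_le_power[of p k] k_pos by linarith

lemma odd_Q: "odd Q"
  using odd_p by simp

lemma card_q_minus_1: "CARD('q) - 1 = (Q - 1) * (Q + 1)"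
proof -
  have "CARD('q) = Q * Q"
    using card_q m_eq by (simp add: mult_2 power_add)
  then show ?thesis
    by (simp add: algebra_simps)
qed

lemma fixed_iff: "(u :: 'q) \<noteq> 0 \<Longrightarrow> u ^ Q = u \<longleftrightarrow> u ^ (Q - 1) = 1"
  using p_pos power_minus_mult[of Q u] by auto

lemma card_fixed_nonzero: "card {u::'q. u \<noteq> 0 \<and> u ^ Q = u} = Q - 1"
proof -
  have "{u::'q. u \<noteq> 0 \<and> u ^ Q = u} = {u. u ^ (Q - 1) = 1}"
  proof (rule Collect_cong)
    fix u :: 'q
    have "u \<noteq> 0" if "u ^ (Q - 1) = 1"
      using that Q_ge by (auto simp: power_0_left)
    then show "(u \<noteq> 0 \<and> u ^ Q = u) = (u ^ (Q - 1) = 1)"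
      using fixed_iff[of u] by argo
  qed
  then show ?thesis
    using card_power_eq[OF card_q_minus_1, of 1] by simp
qed

lemma card_fixed: "card {u::'q. u ^ Q = u} = Q"
proof -
  have "{u::'q. u ^ Q = u} = insert 0 {u. u \<noteq> 0 \<and> u ^ Q = u}"
    using p_pos by auto
  then show ?thesis
    using card_fixed_nonzero Q_ge by simp
qed

text \<open>As \<open>Q + 1\<close> is even, \<open>(q - 1) / 2\<close> is a multiple of
  \<open>Q - 1\<close>, so units of GF(Q) satisfy Euler's criterion in GF(q).\<close>

lemma fixed_is_square:
  assumes "(u :: 'q) ^ Q = u"
  obtains s where "u = s ^ 2"
proof (cases "u = 0")
  case False
  have "card {s. s ^ 2 = u} = 2"
  proof (rule card_power_eq)
    have "even (Q + 1)"
      using odd_Q by simp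
    then show "CARD('q) - 1 = 2 * ((Q - 1) * ((Q + 1) div 2))"
      unfolding card_q_minus_1 by (metis dvd_mult_div_cancel mult.left_commute)
    show "u ^ ((Q - 1) * ((Q + 1) div 2)) = 1"
      using fixed_iff[OF False] assms by (simp add: power_mult)
  qed
  then have "{s. s ^ 2 = u} \<noteq> {}" by (metis card.empty zero_neq_numeral)
  then show ?thesis using that by blast
qed (use that[of 0] in simp)

lemma emb_is_square: obtains s where "emb c = s ^ 2"
  using fixed_is_square emb_power by blast

text \<open>Transitivity of the trace through GF(Q): the Frobenius powers of index \<open>i\<close>
  and \<open>k + i\<close> are paired, and \<open>a\<close> is fixed by
  \<open>x \<mapsto> x ^ Q\<close>.\<close>

lemma tr_fixed_mult:
  assumes "a ^ Q = a"
  shows "tr (a * y) = 0 \<longleftrightarrow> (\<Sum>i<k. (a * (y + y ^ Q)) ^ (p ^ i)) = 0"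
proof -
  have split: "(\<Sum>i<k + j. g i) = (\<Sum>i<k. g i) + (\<Sum>i<j. g (k + i))" for j and g :: "nat \<Rightarrow> 'q"
    by (induction j) (auto simp: add.assoc)
  have "emb (tr (a * y)) = (\<Sum>i<k. (a * y) ^ (p ^ i)) + (\<Sum>i<k. (a * y) ^ (p ^ (k + i)))"
    unfolding emb_tr m_eq mult_2 split ..
  also have "(\<Sum>i<k. (a * y) ^ (p ^ (k + i))) = (\<Sum>i<k. (a * y ^ Q) ^ (p ^ i))"
    using assms by (simp add: power_add power_mult power_mult_distrib)
  also have "(\<Sum>i<k. (a * y) ^ (p ^ i)) + \<dots> = (\<Sum>i<k. (a * (y + y ^ Q)) ^ (p ^ i))"
    by (simp add: distrib_left frobenius_add sum.distrib)
  finally show ?thesis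
    using emb_eq_0_iff by metis
qed

text \<open>Multiplication by the relative trace \<open>y + y ^ Q\<close>, a unit of GF(Q), carries
  the suitable \<open>a\<close> to the nonzero elements of GF(Q) whose trace to GF(p) is
  zero.\<close>

lemma card_fixed_tr_mult_eq_0:
  assumes "y + y ^ Q \<noteq> 0"
  shows "card {a. a \<noteq> 0 \<and> a ^ Q = a \<and> tr (a * y) = 0} = p ^ (k - 1) - 1"
proof -
  let ?b = "y + y ^ Q" and ?N = "{u. u ^ Q = u \<and> (\<Sum>i<k. u ^ (p ^ i)) = (0::'q)}"
  \<comment> \<open>As \<open>Q ^ 2 = q\<close>, the map \<open>x \<mapsto> x ^ Q\<close> swaps the
    two summands of \<open>?b\<close>.\<close>
  have "(y ^ Q) ^ Q = y"
    using power_card[of y] m_eq by (simp add: mult_2 power_add flip: power_mult)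
  then have b: "?b ^ Q = ?b"
    by (simp add: frobenius_add add.commute)
  have "tr (u * y / ?b) = 0" if "u \<in> ?N" for u
    using tr_fixed_mult[of "u / ?b" y] assms b that by (simp add: power_divide)
  then have "bij_betw (\<lambda>a. a * ?b) {a. a \<noteq> 0 \<and> a ^ Q = a \<and> tr (a * y) = 0} (?N - {0})"
    using assms b by (intro bij_betw_byWitness[where f' = "\<lambda>u. u / ?b"])
      (auto simp: tr_fixed_mult power_mult_distrib power_divide)
  then have "card {a. a \<noteq> 0 \<and> a ^ Q = a \<and> tr (a * y) = 0} = card (?N - {0})"
    by (rule bij_betw_same_card)
  also have "\<dots> = card ?N - 1"
    using p_ge by (subst card_Diff_singleton) (auto simp: power_0_left)
  also have "card ?N = p ^ (k - 1)"
    using prime_p CHAR_q k_pos card_fixed p_ge by (intro card_trace_fibre) (auto simp: power_0_left)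
  finally show ?thesis .
qed

section \<open>The sign \<epsilon> and the number of zeros of \<open>T\<close>\<close>

definition eps :: int
  where "eps = (- 1) ^ (((p - 1) div 2) ^ 2 * k)"

text \<open>So \<open>eps\<close> is the quadratic character of \<open>- 1\<close> in GF(Q):
  squaring preserves the parity of \<open>(p - 1) div 2\<close>, and \<open>Q mod 4 = 3\<close>
  exactly when \<open>p mod 4 = 3\<close> and \<open>k\<close> is odd.\<close>

lemma eps_cases:
  obtains "eps = 1" "Q mod 4 = 1" | "eps = - 1" "Q mod 4 = 3"
proof -
  have "p mod 4 = 1 \<or> p mod 4 = 3"
    using odd_p by presburger
  then consider "p mod 4 = 1" | "p mod 4 = 3"
    by blast
  then show ?thesis
  proof cases
    case 1
    then have "even ((p - 1) div 2)"
      by presburger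
    moreover have "Q mod 4 = 1"
      using 1 power_mod[of p 4 k] by simp
    ultimately show ?thesis
      using that by (simp add: eps_def)
  next
    case 2
    then have odd: "odd ((p - 1) div 2)"
      by presburger
    show ?thesis
    proof (cases "even k")
      case True
      then obtain j where j: "k = 2 * j"
        by blast
      have "p ^ 2 mod 4 = 1"
        using 2 power_mod[of p 4 2] by simp
      then have "Q mod 4 = 1"
        using power_mod[of "p ^ 2" 4 j] j by (simp add: power_mult)
      then show ?thesis
        using that True by (simp add: eps_def)
    next
      case False
      then obtain j where j: "k = 2 * j + 1"
        by (blast elim: oddE)
      have "p ^ 2 mod 4 = 1"
        using 2 power_mod[of p 4 2] by simp
      then have "(p ^ 2) ^ j mod 4 = 1"
        using power_mod[of "p ^ 2" 4 j] by simp
      then have "Q mod 4 = 3"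
        using j 2 mod_mult_eq[of p 4 "(p ^ 2) ^ j"] by (simp add: power_mult)
      then show ?thesis
        using that False odd by (simp add: eps_def)
    qed
  qed
qed

text \<open>For \<open>x \<noteq> 0\<close> the equation reads
  \<open>x ^ (2 * (Q - 1)) = - 1\<close>. Its power with exponent \<open>(Q + 1) / 2\<close> has
  left side \<open>1\<close>, so a solution requires this exponent to be even; then there are
  \<open>2 * (Q - 1)\<close> of them. The factor \<open>1 - eps\<close> is \<open>0\<close> or
  \<open>2\<close> accordingly.\<close>

lemma card_norm_sq_eq_0:
  "int (card {x::'q. x \<noteq> 0 \<and> x ^ 2 + (x ^ 2) ^ Q = 0}) = (1 - eps) * (int Q - 1)"
proof -
  have eq: "x ^ 2 + (x ^ 2) ^ Q = 0 \<longleftrightarrow> x ^ (2 * (Q - 1)) = - 1" if "x \<noteq> 0" for x :: 'q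
  proof -
    have "x ^ 2 + (x ^ 2) ^ Q = x ^ 2 * (1 + (x ^ 2) ^ (Q - 1))"
      using power_minus_mult[of Q "x ^ 2"] p_pos by (simp add: algebra_simps)
    then show ?thesis
      using that by (simp add: power_mult add_eq_0_iff)
  qed
  have nz: "x \<noteq> 0" if "x ^ (2 * (Q - 1)) = - 1" for x :: 'q
    using that Q_ge by (auto simp: power_0_left)
  have E: "{x::'q. x \<noteq> 0 \<and> x ^ 2 + (x ^ 2) ^ Q = 0} = {x. x ^ (2 * (Q - 1)) = - 1}"
  proof (rule Collect_cong)
    show "(x \<noteq> 0 \<and> x ^ 2 + (x ^ 2) ^ Q = 0) = (x ^ (2 * (Q - 1)) = - 1)" for x :: 'q
      using eq[of x] nz[of x] by argo
  qed
  have "even (Q + 1)"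
    using odd_Q by simp
  then have "(Q + 1) div 2 * 2 = Q + 1"
    by (rule dvd_div_mult_self)
  then have q: "CARD('q) - 1 = 2 * (Q - 1) * ((Q + 1) div 2)"
    unfolding card_q_minus_1 by (metis mult.assoc mult.commute)
  show ?thesis
  proof (cases rule: eps_cases)
    case 1
    have "\<not> x ^ (2 * (Q - 1)) = - 1" for x :: 'q
    proof
      assume x: "x ^ (2 * (Q - 1)) = - 1"
      then have "x \<noteq> 0"
        using Q_ge by (auto simp: power_0_left)
      moreover have "x ^ (CARD('q) - 1) * x = x"
        using finite_field_power_card_eq_same[of x] power_minus_mult[of "CARD('q)" x] by simp
      ultimately have "x ^ (CARD('q) - 1) = 1"
        by simp
      moreover have "odd ((Q + 1) div 2)"
        using 1 by presburger
      ultimately have "(- 1 :: 'q) = 1"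
        using x unfolding q power_mult by simp
      then have "of_nat 2 = (0 :: 'q)"
        by (metis add_eq_0_iff of_nat_numeral one_add_one)
      then have "p dvd 2"
        unfolding of_nat_eq_0_iff_char_dvd CHAR_q .
      then show False
        using p_ge by (auto dest: dvd_imp_le)
    qed
    then show ?thesis
      using 1 E by simp
  next
    case 2
    have "even ((Q + 1) div 2)"
      using 2 by presburger
    then have "card {x::'q. x ^ (2 * (Q - 1)) = - 1} = 2 * (Q - 1)"
      by (intro card_power_eq[OF q]) simp
    then show ?thesis
      using 2 E Q_ge by (simp add: of_nat_diff)
  qed
qed

text \<open>Pairs of a unit \<open>a\<close> of GF(Q) and some \<open>x \<noteq> 0\<close> with
  \<open>tr (a * x ^ 2) = 0\<close> are counted in both orders.\<close>

lemma card_zeros: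
  "int (card {x. x \<noteq> 0 \<and> tr (x ^ 2) = 0}) =
     int p ^ (m - 1) - 1 - eps * (int p - 1) * int p ^ (k - 1)"
proof -
  let ?D = "{x. x \<noteq> 0 \<and> tr (x ^ 2) = 0}"
  let ?A = "{a::'q. a \<noteq> 0 \<and> a ^ Q = a}" and ?X = "{x::'q. x \<noteq> 0}"
  let ?E = "{x::'q. x \<noteq> 0 \<and> x ^ 2 + (x ^ 2) ^ Q = 0}"
  \<comment> \<open>With \<open>a = s ^ 2\<close>, the substitution of \<open>s * x\<close> for
    \<open>x\<close> absorbs \<open>a\<close>.\<close>
  have "card {x \<in> ?X. tr (a * x ^ 2) = 0} = card ?D" if "a \<in> ?A" for a
  proof -
    obtain s where s: "a = s ^ 2"
      using \<open>a \<in> ?A\<close> fixed_is_square by blast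
    then have "s \<noteq> 0"
      using \<open>a \<in> ?A\<close> by auto
    then have "bij_betw (\<lambda>x. s * x) {x \<in> ?X. tr (a * x ^ 2) = 0} ?D"
      by (intro bij_betw_byWitness[where f' = "\<lambda>x. x / s"])
        (auto simp: s power_mult_distrib power_divide)
    then show ?thesis by (rule bij_betw_same_card)
  qed
  then have "(Q - 1) * card ?D = (\<Sum>a\<in>?A. card {x \<in> ?X. tr (a * x ^ 2) = 0})"
    using card_fixed_nonzero by simp
  also have "\<dots> = (\<Sum>x\<in>?X. card {a \<in> ?A. tr (a * x ^ 2) = 0})"
    by (rule sum_multicount_gen) auto
  also have "\<dots> = (\<Sum>x\<in>?E. Q - 1) + (\<Sum>x\<in>?X - ?E. p ^ (k - 1) - 1)"
  proof -
    \<comment> \<open>Every \<open>a\<close> qualifies when the relative trace of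
      \<open>x ^ 2\<close> vanishes.\<close>
    have E: "card {a \<in> ?A. tr (a * x ^ 2) = 0} = Q - 1" if "x \<in> ?E" for x
    proof -
      have "{a \<in> ?A. tr (a * x ^ 2) = 0} = ?A"
        using that p_pos tr_fixed_mult[of _ "x ^ 2"] by (auto simp: power_0_left)
      then show ?thesis
        using card_fixed_nonzero by simp
    qed
    have XE: "card {a \<in> ?A. tr (a * x ^ 2) = 0} = p ^ (k - 1) - 1" if "x \<in> ?X - ?E" for x
    proof -
      have "x ^ 2 + (x ^ 2) ^ Q \<noteq> 0"
        using that by auto
      then show ?thesis
        using card_fixed_tr_mult_eq_0[of "x ^ 2"] by (simp add: conj_assoc)
    qed
    have "?E \<subseteq> ?X"
      by auto
    then have "(\<Sum>x\<in>?X. card {a \<in> ?A. tr (a * x ^ 2) = 0}) =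
        (\<Sum>x\<in>?X - ?E. card {a \<in> ?A. tr (a * x ^ 2) = 0}) +
        (\<Sum>x\<in>?E. card {a \<in> ?A. tr (a * x ^ 2) = 0})"
      by (rule sum.subset_diff) simp
    also have "(\<Sum>x\<in>?X - ?E. card {a \<in> ?A. tr (a * x ^ 2) = 0}) =
        (\<Sum>x\<in>?X - ?E. p ^ (k - 1) - 1)"
      by (rule sum.cong[OF refl XE])
    also have "(\<Sum>x\<in>?E. card {a \<in> ?A. tr (a * x ^ 2) = 0}) = (\<Sum>x\<in>?E. Q - 1)"
      by (rule sum.cong[OF refl E])
    finally show ?thesis
      by (simp only: add.commute)
  qed
  also have "\<dots> = card ?E * (Q - 1) + ((Q - 1) * (Q + 1) - card ?E) * (p ^ (k - 1) - 1)"
  proof -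
    have "?X = UNIV - {0}"
      by auto
    then have "card ?X = (Q - 1) * (Q + 1)"
      using card_q_minus_1 by (simp add: card_Diff_singleton)
    moreover have "card (?X - ?E) = card ?X - card ?E"
      by (intro card_Diff_subset) auto
    ultimately show ?thesis by simp
  qed
  finally have count: "(Q - 1) * card ?D =
      card ?E * (Q - 1) + ((Q - 1) * (Q + 1) - card ?E) * (p ^ (k - 1) - 1)" .
  \<comment> \<open>This bound makes the truncated subtraction in \<open>count\<close>
    exact.\<close>
  have "card ?E \<le> card (UNIV - {0 :: 'q})"
    by (intro card_mono) auto
  also have "\<dots> = (Q - 1) * (Q + 1)"
    using card_q_minus_1 by (simp add: card_Diff_singleton)
  finally have le: "card ?E \<le> (Q - 1) * (Q + 1)" .
  define R where "R = int p ^ (k - 1)"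
  have QR: "int Q = int p * R"
    using k_pos by (cases k) (auto simp: R_def)
  have "(int Q - 1) * int (card ?D) =
      int (card ?E) * (int Q - 1) + ((int Q - 1) * (int Q + 1) - int (card ?E)) * (R - 1)"
    using arg_cong[OF count, of int] le p_pos
    by (simp add: of_nat_diff R_def del: mult_Suc_right)
  \<comment> \<open>The size of \<open>?E\<close> is itself a multiple of \<open>Q - 1\<close>, so
    this factor cancels from the whole count.\<close>
  also have "\<dots> = (int Q - 1) *
      ((1 - eps) * (int Q - 1) + (int Q + 1 - (1 - eps)) * (R - 1))"
    unfolding card_norm_sq_eq_0 by (simp add: algebra_simps)
  finally have eq: "(int Q - 1) * int (card ?D) = (int Q - 1) *
      ((1 - eps) * (int Q - 1) + (int Q + 1 - (1 - eps)) * (R - 1))" .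
  have "int (card ?D) = (1 - eps) * (int Q - 1) + (int Q + 1 - (1 - eps)) * (R - 1)"
  proof -
    have "int Q - 1 \<noteq> 0"
      using Q_ge by linarith
    with eq show ?thesis
      by (rule mult_left_cancel[THEN iffD1, rotated])
  qed
  also have "\<dots> = int Q * R - 1 - eps * (int Q - R)"
    by (simp add: algebra_simps)
  also have "\<dots> = int p ^ (m - 1) - 1 - eps * (int p - 1) * R"
  proof -
    have "int p ^ (m - 1) = int Q * R"
      using m_eq k_pos by (simp add: R_def flip: power_add) (simp add: mult_2)
    then show ?thesis
      unfolding QR by (simp add: algebra_simps)
  qed
  finally show ?thesis
    by (simp add: R_def)
qed

section \<open>Values of \<open>T\<close> and its zeros off a hyperplane\<close>

lemma tr_sq_scale: "tr ((emb c * x) ^ 2) = c ^ 2 * tr (x ^ 2)"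
proof -
  have "(emb c * x) ^ 2 = emb (c ^ 2) * x ^ 2"
    by (simp add: power2_eq_square emb_mult algebra_simps)
  then show ?thesis by (simp add: tr_scale)
qed

lemma tr_sq_add: "tr ((y + emb c * x) ^ 2) = tr (y ^ 2) + 2 * c * tr (x * y) + c ^ 2 * tr (x ^ 2)"
proof -
  have "emb (2 * c) = 2 * emb c"
    unfolding mult_2 emb_add ..
  then have "(y + emb c * x) ^ 2 = y ^ 2 + emb (2 * c) * (x * y) + (emb c * x) ^ 2"
    by (simp add: power2_eq_square algebra_simps)
  then show ?thesis by (simp add: tr_add tr_scale tr_sq_scale)
qed

lemma tr_mult_add: "tr (x * (y + emb c * z)) = tr (x * y) + c * tr (x * z)"
  using tr_scale[of c "x * z"] by (simp add: distrib_left tr_add mult.left_commute)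

lemma add_emb_uminus: "y + emb c * x + emb (- c) * x = y"
proof -
  have "emb (- c) = - emb c"
    using emb_add[of "- c" c] emb_0 by (simp add: eq_neg_iff_add_eq_0)
  then show ?thesis by simp
qed

lemma card_nonzero_scalars: "card {a :: 'p mod_ring. a \<noteq> 0} = p - 1"
proof -
  have "{a :: 'p mod_ring. a \<noteq> 0} = UNIV - {0}"
    by auto
  then show ?thesis
    by (simp add: card_Diff_singleton p_def)
qed

text \<open>Elements of GF(p) are squares in GF(q), and scaling the argument by a square root of
  \<open>c\<close> multiplies \<open>T\<close> by \<open>c\<close>.\<close>

lemma card_tr_sq_eq:
  assumes "c \<noteq> 0"
  shows "card {x. tr (x ^ 2) = c} = card {x. tr (x ^ 2) = 1}"
proof -
  obtain s where s: "emb c = s ^ 2"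
    using emb_is_square by blast
  then have "s \<noteq> 0"
    using assms emb_eq_0_iff[of c] by auto
  have 1: "tr ((s * x) ^ 2) = c \<longleftrightarrow> tr (x ^ 2) = 1" for x
  proof -
    have "tr ((s * x) ^ 2) = c * tr (x ^ 2)"
      using tr_scale[of c "x ^ 2"] s by (simp add: power_mult_distrib)
    then show ?thesis
      using assms by simp
  qed
  then have 2: "tr ((x / s) ^ 2) = 1 \<longleftrightarrow> tr (x ^ 2) = c" for x
    using 1[of "x / s"] \<open>s \<noteq> 0\<close> by simp
  have "bij_betw (\<lambda>x. s * x) {x. tr (x ^ 2) = 1} {x. tr (x ^ 2) = c}"
  proof (rule bij_betw_byWitness[where f' = "\<lambda>x. x / s"])
    show "(\<lambda>x. x / s) ` {x. tr (x ^ 2) = c} \<subseteq> {x. tr (x ^ 2) = 1}"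
      using 2 by blast
    show "(\<lambda>x. s * x) ` {x. tr (x ^ 2) = 1} \<subseteq> {x. tr (x ^ 2) = c}"
      using 1 by blast
  qed (use \<open>s \<noteq> 0\<close> in auto)
  then show ?thesis
    by (rule bij_betw_same_card[symmetric])
qed

text \<open>For \<open>a \<noteq> 0\<close> both \<open>t * a ^ 2\<close> and \<open>a\<close> are
  nonzero, hence equally frequent values of \<open>T\<close>. After replacing one by the other, the
  fibre sizes over all \<open>a\<close> add up to \<open>q\<close>.\<close>

lemma card_tr_sq_eq_mult_sq:
  assumes "t \<noteq> 0"
  shows "card {(y, a). tr (y ^ 2) = t * a ^ 2} = p ^ m"
proof -
  let ?Z = "\<lambda>c. card {y. tr (y ^ 2) = c}"
  let ?S = "{(y, a). tr (y ^ 2) = t * a ^ 2}"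
  have "card {s \<in> ?S. snd s = a} = ?Z (t * a ^ 2)" for a
  proof -
    have "{s \<in> ?S. snd s = a} = (\<lambda>y. (y, a)) ` {y. tr (y ^ 2) = t * a ^ 2}"
      by auto
    then show ?thesis
      by (simp add: card_image inj_on_def)
  qed
  then have "card ?S = (\<Sum>a\<in>UNIV. ?Z (t * a ^ 2))"
    using card_eq_sum_fibres[of ?S UNIV snd] by (metis (no_types, lifting) finite subset_UNIV sum.cong)
  also have "\<dots> = ?Z 0 + (\<Sum>a\<in>UNIV - {0}. ?Z (t * a ^ 2))"
    by (subst sum.remove[of UNIV 0]) auto
  also have "(\<Sum>a\<in>UNIV - {0}. ?Z (t * a ^ 2)) = (\<Sum>a\<in>UNIV - {0}. ?Z a)"
  proof (rule sum.cong[OF refl])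
    fix a :: "'p mod_ring" assume "a \<in> UNIV - {0}"
    then show "?Z (t * a ^ 2) = ?Z a"
      using card_tr_sq_eq[of "t * a ^ 2"] card_tr_sq_eq[of a] assms by simp
  qed
  also have "?Z 0 + \<dots> = (\<Sum>a\<in>UNIV. ?Z a)"
    by (subst sum.remove[of UNIV 0]) auto
  also have "\<dots> = CARD('q)"
    using card_eq_sum_fibres[of UNIV UNIV "\<lambda>y. tr (y ^ 2)"] by simp
  finally show ?thesis
    using card_q by simp
qed

text \<open>This is \<open>p - 1\<close> times the weight of the codeword of \<open>x\<close>: the
  vector \<open>y = 0\<close> fails the first condition, so only elements of \<open>D\<close> are
  counted.\<close>

abbreviation "hits x \<equiv> card {y. tr (x * y) \<noteq> 0 \<and> tr (y ^ 2) = 0}"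

text \<open>Here \<open>x\<close> itself is the isotropic vector, and one in \<open>p\<close> of the
  \<open>p ^ m - p ^ (m - 1)\<close> vectors not orthogonal to \<open>x\<close> is a zero of
  \<open>T\<close>.\<close>

lemma hits_isotropic:
  assumes "x \<noteq> 0" "tr (x ^ 2) = 0"
  shows "int (hits x) = (int p - 1) * int p ^ (m - 2)"
proof -
  have "p * hits x = card {y. tr (x * y) \<noteq> 0}"
    unfolding p_def
  proof (rule card_isotropic_shift[where \<sigma> = "\<lambda>c y. y + emb c * x"])
    show "y + emb c * x + emb (- c) * x = y" for c y
      by (simp add: add_emb_uminus)
    show "tr (x * (y + emb c * x)) = tr (x * y)" for c y
      using assms by (simp add: tr_mult_add power2_eq_square)
    show "tr ((y + emb c * x) ^ 2) = tr (y ^ 2) + 2 * c * tr (x * y)" for c y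
      using assms by (simp add: tr_sq_add)
  qed (use odd_p p_def in simp)
  also have "{y. tr (x * y) \<noteq> 0} = UNIV - {y. tr (x * y) = 0}"
    by auto
  also have "card \<dots> = p ^ m - p ^ (m - 1)"
    using card_tr_mult_eq[OF assms(1)] by (subst card_Diff_subset) (auto simp: card_q)
  finally have "int p * int (hits x) = int p ^ m - int p ^ (m - 1)"
    using p_pos by (simp add: of_nat_diff power_increasing flip: of_nat_mult of_nat_power)
  also have "\<dots> = int p * ((int p - 1) * int p ^ (m - 2))"
    using m_eq k_pos by (cases k) (auto simp: algebra_simps)
  finally show ?thesis
    using p_pos by simp
qed

text \<open>The form \<open>\<tau>\<close> has \<open>p ^ m\<close> zeros, of which
  \<open>p ^ m - p ^ (m - 1)\<close> lie off the hyperplane \<open>\<beta> = 0\<close> orthogonal to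
  \<open>(x, 1)\<close>. The other \<open>p ^ (m - 1)\<close> zeros fill lines parallel to
  \<open>(x, 1)\<close>, one for each \<open>y\<close> sought.\<close>

lemma card_zeros_orthogonal:
  assumes "tr (x ^ 2) \<noteq> 0"
  shows "card {y. tr (x * y) = 0 \<and> tr (y ^ 2) = 0} = p ^ (m - 2)"
proof -
  let ?t = "tr (x ^ 2)"
  define \<tau> where "\<tau> = (\<lambda>(y, a). tr (y ^ 2) - ?t * a ^ 2)"
  define \<sigma> where "\<sigma> = (\<lambda>c (y, a). (y + emb c * x, a + c))"
  define \<beta> where "\<beta> = (\<lambda>(y, a). tr (x * y) - ?t * a)"
  have nz: "p * card {s. \<beta> s \<noteq> 0 \<and> \<tau> s = 0} = card {s. \<beta> s \<noteq> 0}"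
    unfolding p_def
  proof (rule card_isotropic_shift[where \<sigma> = \<sigma>])
    show "\<sigma> (- c) (\<sigma> c s) = s" for c s
      by (cases s) (simp add: \<sigma>_def add_emb_uminus)
    show "\<beta> (\<sigma> c s) = \<beta> s" for c s
      by (cases s) (simp add: \<sigma>_def \<beta>_def tr_mult_add, simp add: power2_eq_square algebra_simps)
    show "\<tau> (\<sigma> c s) = \<tau> s + 2 * c * \<beta> s" for c s
      by (cases s) (simp add: \<sigma>_def \<beta>_def \<tau>_def tr_sq_add, simp add: power2_eq_square algebra_simps)
  qed (use odd_p p_def in simp)
  have "{s. \<beta> s = 0} = (\<lambda>y. (y, tr (x * y) / ?t)) ` UNIV"
    using assms by (auto simp: \<beta>_def field_simps)
  then have "card {s. \<beta> s = 0} = p ^ m"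
    by (simp add: card_image inj_on_def card_q)
  moreover have "{s. \<beta> s \<noteq> 0} = UNIV - {s. \<beta> s = 0}"
    by auto
  ultimately have "card {s. \<beta> s \<noteq> 0} = p ^ m * p - p ^ m"
    by (simp add: card_Diff_subset card_q flip: p_def)
  then have "p * card {s. \<beta> s \<noteq> 0 \<and> \<tau> s = 0} = p * (p ^ m - p ^ (m - 1))"
    using nz m_eq k_pos by (cases k) (auto simp: algebra_simps diff_mult_distrib2)
  then have "card {s. \<beta> s \<noteq> 0 \<and> \<tau> s = 0} = p ^ m - p ^ (m - 1)"
    using p_pos by simp
  moreover have "card {s. \<tau> s = 0} = p ^ m"
    using card_tr_sq_eq_mult_sq[OF assms] by (simp add: \<tau>_def case_prod_unfold)
  moreover have "{s. \<beta> s = 0 \<and> \<tau> s = 0} = {s. \<tau> s = 0} - {s. \<beta> s \<noteq> 0 \<and> \<tau> s = 0}"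
    by auto
  ultimately have "card {s. \<beta> s = 0 \<and> \<tau> s = 0} = p ^ m - (p ^ m - p ^ (m - 1))"
    by (simp add: card_Diff_subset subset_eq)
  also have "\<dots> = p ^ (m - 1)"
    using p_pos by (simp add: power_increasing)
  finally have card0: "card {s. \<beta> s = 0 \<and> \<tau> s = 0} = p ^ (m - 1)" .
  \<comment> \<open>Both conditions are invariant along \<open>(x, 1)\<close>. Each such line has
    one point with second coordinate \<open>0\<close>, where \<open>\<beta>\<close> and
    \<open>\<tau>\<close> become \<open>tr (x * y)\<close> and \<open>tr (y ^ 2)\<close>.\<close>
  have "bij_betw (\<lambda>(y, a). (y + emb a * x, a)) ({y. tr (x * y) = 0 \<and> tr (y ^ 2) = 0} \<times> UNIV)
      {s. \<beta> s = 0 \<and> \<tau> s = 0}"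
  proof (rule bij_betw_byWitness[where f' = "\<lambda>(y, a). (y - emb a * x, a)"])
    have "tr (x * (y - emb a * x)) = 0 \<and> tr ((y - emb a * x) ^ 2) = 0"
      if "\<beta> (y, a) = 0" "\<tau> (y, a) = 0" for y a
    proof -
      have "tr (x * y) = tr (x * (y - emb a * x)) + a * ?t"
        using tr_mult_add[of x "y - emb a * x" a x] by (simp add: power2_eq_square)
      then have 0: "tr (x * (y - emb a * x)) = 0"
        using that by (simp add: \<beta>_def)
      then have "tr (y ^ 2) = tr ((y - emb a * x) ^ 2) + a ^ 2 * ?t"
        using tr_sq_add[of "y - emb a * x" a x] by simp
      then show ?thesis
        using 0 that by (simp add: \<tau>_def)
    qed
    then show "(\<lambda>(y, a). (y - emb a * x, a)) ` {s. \<beta> s = 0 \<and> \<tau> s = 0}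
        \<subseteq> {y. tr (x * y) = 0 \<and> tr (y ^ 2) = 0} \<times> UNIV"
      by auto
  qed (auto simp: \<beta>_def \<tau>_def tr_mult_add tr_sq_add simp flip: power2_eq_square)
  then have "card {y. tr (x * y) = 0 \<and> tr (y ^ 2) = 0} * p = p ^ (m - 1)"
    using bij_betw_same_card card0 by (fastforce simp: card_cartesian_product p_def)
  also have "\<dots> = p ^ (m - 2) * p"
    using m_eq k_pos by (cases k) auto
  finally show ?thesis
    using p_pos by simp
qed

text \<open>The zeros orthogonal to \<open>x\<close> are removed from all zeros of \<open>T\<close>;
  including \<open>0\<close> among the latter cancels the \<open>- 1\<close> of
  \<open>card_zeros\<close>.\<close>

lemma hits_anisotropic:
  assumes "tr (x ^ 2) \<noteq> 0"
  shows "int (hits x) = (int p - 1) * (int p ^ (m - 2) - eps * int p ^ (k - 1))"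
proof -
  let ?Z = "{y. tr (y ^ 2) = 0}"
  have "?Z = insert 0 {x. x \<noteq> 0 \<and> tr (x ^ 2) = 0}"
    using tr_0 by auto
  then have Z: "int (card ?Z) = int p ^ (m - 1) - eps * (int p - 1) * int p ^ (k - 1)"
    using card_zeros by simp
  have "card ?Z = card ({y. tr (x * y) = 0 \<and> tr (y ^ 2) = 0} \<union> {y. tr (x * y) \<noteq> 0 \<and> tr (y ^ 2) = 0})"
    by (rule arg_cong[of _ _ card]) auto
  also have "\<dots> = p ^ (m - 2) + hits x"
    using card_zeros_orthogonal[OF assms] by (subst card_Un_disjoint) auto
  finally have "int (hits x) = int (card ?Z) - int p ^ (m - 2)"
    by simp
  moreover have "int p ^ (m - 1) = int p * int p ^ (m - 2)"
    using m_eq k_pos by (cases k) auto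
  ultimately show ?thesis
    unfolding Z by (simp add: algebra_simps)
qed

section \<open>From \<open>D\<close> to its representatives\<close>

text \<open>Nonzero scalars and indices parametrize \<open>D\<close> bijectively by
  \<open>emb a * d i\<close>, and \<open>R\<close> ignores the scalar. A constantly true
  \<open>R\<close> yields the length, the condition \<open>tr (x * y) \<noteq> 0\<close> the
  weights.\<close>

lemma card_representatives:
  fixes d :: "'n::finite \<Rightarrow> 'q"
  assumes D: "D = {emb a * b | a b. a \<noteq> 0 \<and> b \<in> range d}"
    and d: "\<And>i j. i \<noteq> j \<Longrightarrow> d i / d j \<notin> emb ` {a. a \<noteq> 0}"
    and "0 \<notin> D"
    and R: "\<And>a y. a \<noteq> 0 \<Longrightarrow> R (emb a * y) \<longleftrightarrow> R y"
  shows "card {y \<in> D. R y} = (p - 1) * card {i. R (d i)}"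
proof -
  let ?f = "\<lambda>(a, i). emb a * d i"
  have D_i: "emb a * d i \<in> D" if "a \<noteq> 0" for a i
    using that D by auto
  have nz: "d i \<noteq> 0" for i
    using D_i[of 1 i] \<open>0 \<notin> D\<close> by auto
  have "inj_on ?f ({a. a \<noteq> 0} \<times> {i. R (d i)})"
  proof (rule inj_onI, clarify)
    fix a b i j
    assume "a \<noteq> 0" "b \<noteq> 0" and eq: "emb a * d i = emb b * d j"
    have "emb (b / a) * emb a = emb b"
      using \<open>a \<noteq> 0\<close> by (simp flip: emb_mult)
    then have "emb a * d i = emb a * (emb (b / a) * d j)"
      using eq by (metis mult.assoc mult.commute)
    then have "d i / d j = emb (b / a)"
      using \<open>a \<noteq> 0\<close> nz by (simp add: emb_eq_0_iff)
    then have "d i / d j \<in> emb ` {a. a \<noteq> 0}"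
      using \<open>a \<noteq> 0\<close> \<open>b \<noteq> 0\<close> by auto
    then have "i = j"
      using d by blast
    then show "a = b \<and> i = j"
      using eq nz emb_eq_iff by simp
  qed
  moreover have "?f ` ({a. a \<noteq> 0} \<times> {i. R (d i)}) = {y \<in> D. R y}"
  proof safe
    fix y assume "y \<in> D" "R y"
    then obtain a i where y: "y = emb a * d i" and "a \<noteq> 0"
      using D by auto
    then show "y \<in> ?f ` ({a. a \<noteq> 0} \<times> {i. R (d i)})"
      using \<open>R y\<close> R by (intro image_eqI[of _ _ "(a, i)"]) auto
  qed (use D_i R in auto)
  ultimately have "card {y \<in> D. R y} = card ({a :: 'p mod_ring. a \<noteq> 0} \<times> {i. R (d i)})"
    by (intro bij_betw_same_card[symmetric]) (rule bij_betw_imageI)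
  then show ?thesis
    by (simp add: card_cartesian_product card_nonzero_scalars)
qed

end

section \<open>Length, dimension and weight distribution of the code\<close>

theorem corollary4:
  fixes p m :: nat
    and \<epsilon> :: int
    and D :: "'q::finite_field set"
    and d :: "'n::finite \<Rightarrow> 'q"
    and C :: "('p::prime_card mod_ring ^ 'n) set"
  assumes "prime p" and "odd p" and "CARD('p) = p"
    and "m \<ge> 2" and "even m"
    and "CARD('q) = p ^ m"
    and "D = {x. x \<noteq> 0 \<and> gf_trace m (x ^ 2) = (0 :: 'p mod_ring)}"
    and "D = {gf_embed a * b | (a :: 'p mod_ring) b. a \<noteq> 0 \<and> b \<in> range d}"
    and "\<And>i j. i \<noteq> j \<Longrightarrow> d i / d j \<notin> gf_embed ` {a :: 'p mod_ring. a \<noteq> 0}"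
    and "\<epsilon> = (- 1) ^ (((p - 1) div 2) ^ 2 * (m div 2))"
    and "C = trace_code m d"
  shows "real CARD('n) = (real p ^ (m - 1) - 1) / (real p - 1) - of_int \<epsilon> * real p ^ ((m - 2) div 2)
    \<and> linear_code C m
    \<and> weight_count C 0 = 1
    \<and> (\<forall>w. int w = int p ^ (m - 2) \<longrightarrow>
          int (weight_count C w) = int p ^ (m - 1) - \<epsilon> * (int p - 1) * int p ^ ((m - 2) div 2) - 1)
    \<and> (\<forall>w. int w = int p ^ (m - 2) - \<epsilon> * int p ^ ((m - 2) div 2) \<longrightarrow>
          int (weight_count C w) = (int p - 1) * (int p ^ (m - 1) + \<epsilon> * int p ^ ((m - 2) div 2)))
    \<and> (\<forall>w. w \<noteq> 0 \<and> int w \<noteq> int p ^ (m - 2) \<and> int w \<noteq> int p ^ (m - 2) - \<epsilon> * int p ^ ((m - 2) div 2)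
          \<longrightarrow> weight_count C w = 0)"
proof -
  define k where "k = m div 2"
  have mk: "m = 2 * k" "0 < k"
    using assms(4,5) by (auto simp: k_def)
  interpret gf_extension "gf_trace m :: 'q \<Rightarrow> 'p mod_ring" gf_embed p m k
    by unfold_locales (use assms(2,3,6) mk in auto)
  let ?tr = "gf_trace m :: 'q \<Rightarrow> 'p mod_ring"
  have eps: "\<epsilon> = eps"
    unfolding eps_def using assms(10) by (simp add: k_def)
  \<comment> \<open>With \<open>R = p ^ ((m - 2) div 2)\<close> all powers of \<open>p\<close> that
    occur become monomials in \<open>p\<close> and \<open>R\<close>.\<close>
  define R where "R = int p ^ (k - 1)"
  have pow: "int p ^ (m - 1) = int p * R ^ 2" "int p ^ (m - 2) = R ^ 2" "int p ^ m = int p ^ 2 * R ^ 2"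
      "int p ^ ((m - 2) div 2) = R"
    using mk by (cases k; simp add: R_def power_mult_distrib flip: power_mult; simp add: power2_eq_square mult.commute power_add mult_2)+
  have R_pos: "0 < R"
    using p_pos by (simp add: R_def)
  have eps_sq: "eps = 1 \<or> eps = - 1"
    using eps_cases by metis
  have card_D: "int (card D) = int p * R ^ 2 - 1 - eps * (int p - 1) * R"
    unfolding assms(7) card_zeros pow by (simp only: R_def)
  have "0 \<notin> D"
    using assms(7) by simp
  note reps = card_representatives[OF assms(8,9) this]
  have "card D = (p - 1) * CARD('n)"
    using reps[of "\<lambda>_. True"] by simp
  then have card_D': "int (card D) = (int p - 1) * int CARD('n)"
    using p_pos by (simp add: of_nat_diff)

  define c where "c x = (\<chi> i. ?tr (x * d i))" for x
  have C: "C = range c"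
    using assms(11) by (auto simp: trace_code_def c_def)
  have wt: "int (hits x) = (int p - 1) * int (hamming_weight (c x))" for x
  proof -
    have "{y \<in> D. ?tr (x * y) \<noteq> 0} = {y. ?tr (x * y) \<noteq> 0 \<and> ?tr (y ^ 2) = 0}"
      using assms(7) tr_0 by auto
    moreover have "card {y \<in> D. ?tr (x * y) \<noteq> 0} = (p - 1) * card {i. ?tr (x * d i) \<noteq> 0}"
    proof (rule reps)
      fix a :: "'p mod_ring" and y assume "a \<noteq> 0"
      moreover have "?tr (x * (gf_embed a * y)) = a * ?tr (x * y)"
        using tr_mult_add[of x 0 a y] tr_0 by simp
      ultimately show "?tr (x * (gf_embed a * y)) \<noteq> 0 \<longleftrightarrow> ?tr (x * y) \<noteq> 0"
        by simp
    qed
    ultimately show ?thesis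
      using p_pos by (simp add: hamming_weight_def c_def of_nat_diff)
  qed
  have p1: "int p - 1 \<noteq> 0"
    using p_ge by linarith
  have wt_0: "hamming_weight (c 0) = 0"
    by (simp add: hamming_weight_def c_def tr_0)
  have wt_iso: "int (hamming_weight (c x)) = R ^ 2" if "x \<noteq> 0" "?tr (x ^ 2) = 0" for x
    using hits_isotropic[OF that, unfolded wt pow] p1 by simp
  have wt_aniso: "int (hamming_weight (c x)) = R ^ 2 - eps * R" if "?tr (x ^ 2) \<noteq> 0" for x
    using hits_anisotropic[OF that, unfolded wt pow, folded R_def] p1 by simp
  \<comment> \<open>A zero would force \<open>R = 1\<close> and \<open>eps = 1\<close>, making
    \<open>D\<close> empty, whereas the nonempty index type \<open>'n\<close> supplies a
    representative.\<close>
  have aniso_pos: "R ^ 2 - eps * R \<noteq> 0"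
  proof
    assume "R ^ 2 - eps * R = 0"
    then have "R * (R - eps) = 0"
      by (simp add: power2_eq_square algebra_simps)
    then have "R = eps"
      using R_pos by simp
    then have "R = 1" "eps = 1"
      using R_pos eps_sq by auto
    then have "card D = 0"
      using card_D by simp
    then show False
      using card_D' p1 by simp
  qed
  have iso_ne: "R ^ 2 \<noteq> R ^ 2 - eps * R"
    using R_pos eps_sq by auto
  \<comment> \<open>This makes the linear map \<open>c\<close> injective, so codewords can be
    counted through \<open>x\<close>.\<close>
  have wt_eq_0: "hamming_weight (c x) = 0 \<longleftrightarrow> x = 0" for x
  proof -
    have "int (hamming_weight (c x)) \<noteq> 0" if "x \<noteq> 0"
      using that wt_iso[of x] wt_aniso[of x] aniso_pos R_pos
      by (cases "?tr (x ^ 2) = 0") (simp_all del: of_nat_eq_0_iff)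
    then show ?thesis
      using wt_0 by (cases "x = 0") auto
  qed

  have c_add: "c (x + y) = c x + c y" for x y
    by (simp add: c_def vec_eq_iff distrib_right tr_add)
  have c_scale: "a *s c x = c (gf_embed a * x)" for a x
    by (simp add: c_def vec_eq_iff mult.assoc tr_scale)
  have "inj c"
  proof (rule injI)
    fix x y assume "c x = c y"
    moreover have "c (x - y) + c y = c x"
      by (simp flip: c_add)
    ultimately have "c (x - y) = 0"
      by simp
    then have "hamming_weight (c (x - y)) = 0"
      by (simp add: hamming_weight_def)
    then show "x = y"
      using wt_eq_0 by simp
  qed
  have count: "weight_count C w = card {x. hamming_weight (c x) = w}" for w
  proof -
    have "{v \<in> C. hamming_weight v = w} = c ` {x. hamming_weight (c x) = w}"
      by (auto simp: C)
    then show ?thesis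
      using card_image[OF inj_on_subset[OF \<open>inj c\<close>]] by (simp add: weight_count_def)
  qed

  have "linear_code C m"
  proof -
    have "c 0 = 0"
      using tr_0 by (simp add: c_def vec_eq_iff)
    then have sub: "vec.subspace C"
      unfolding C by (intro vec.subspaceI) (auto simp: c_scale simp flip: c_add intro: range_eqI[of _ _ 0])
    \<comment> \<open>The dimension is the exponent in the number of codewords.\<close>
    have "p ^ m = card C"
      unfolding C using card_image[OF \<open>inj c\<close>] card_q by simp
    also have "\<dots> = p ^ vec.dim C"
      using card_subspace_eq[OF sub] by (simp add: p_def)
    finally have "vec.dim C = m"
      using p_ge by (simp add: power_inject_exp)
    with sub show ?thesis
      by (simp add: linear_code_def)
  qed
  moreover have "real CARD('n) = (real p ^ (m - 1) - 1) / (real p - 1) - of_int \<epsilon> * real p ^ ((m - 2) div 2)"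
  proof -
    have "real_of_int ((int p - 1) * int CARD('n)) = real_of_int (int p ^ (m - 1) - 1 - eps * (int p - 1) * int p ^ ((m - 2) div 2))"
      unfolding pow card_D[symmetric] card_D' ..
    then show ?thesis
      using p_ge by (simp add: eps field_simps)
  qed
  moreover have "weight_count C 0 = 1"
    by (simp add: count wt_eq_0)
  moreover have "int (weight_count C w) = int p * R ^ 2 - eps * (int p - 1) * R - 1" if "int w = R ^ 2" for w
  proof -
    \<comment> \<open>The zero word is excluded by \<open>R > 0\<close>, the anisotropic
      \<open>x\<close> by \<open>eps * R \<noteq> 0\<close>.\<close>
    have "hamming_weight (c x) = w \<longleftrightarrow> x \<in> D" for x
      using that wt_0 wt_iso[of x] wt_aniso[of x] iso_ne R_pos assms(7)
      by (cases "x = 0"; cases "?tr (x ^ 2) = 0") auto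
    then show ?thesis
      using card_D by (simp add: count)
  qed
  moreover have "int (weight_count C w) = (int p - 1) * (int p * R ^ 2 + eps * R)" if "int w = R ^ 2 - eps * R" for w
  proof -
    \<comment> \<open>Here \<open>aniso_pos\<close> excludes the zero word, leaving exactly the
      anisotropic \<open>x\<close>.\<close>
    have "hamming_weight (c x) = w \<longleftrightarrow> x \<notin> insert 0 D" for x
      using that wt_0 wt_iso[of x] wt_aniso[of x] iso_ne aniso_pos assms(7) tr_0
      by (cases "x = 0"; cases "?tr (x ^ 2) = 0") auto
    then have "weight_count C w = card (UNIV - insert 0 D)"
      by (simp add: count Compl_eq_Diff_UNIV[symmetric] Compl_eq)
    also have "\<dots> = p ^ m - card (insert 0 D)"
      by (subst card_Diff_subset) (auto simp: card_q)
    finally have "weight_count C w = p ^ m - card (insert 0 D)" .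
    moreover have "card (insert 0 D) \<le> p ^ m"
      using card_mono[of UNIV "insert 0 D"] card_q by simp
    ultimately have "int (weight_count C w) = int p ^ m - int (card D) - 1"
      using \<open>0 \<notin> D\<close> by (simp add: of_nat_diff)
    then show ?thesis
      unfolding pow card_D by (simp add: power2_eq_square algebra_simps)
  qed
  moreover have "weight_count C w = 0" if "w \<noteq> 0" "int w \<noteq> R ^ 2" "int w \<noteq> R ^ 2 - eps * R" for w
  proof -
    have "hamming_weight (c x) \<noteq> w" for x
      using that wt_0 wt_iso[of x] wt_aniso[of x]
      by (cases "x = 0"; cases "?tr (x ^ 2) = 0") auto
    then show ?thesis
      by (simp add: count)
  qed
  ultimately show ?thesis
    unfolding pow eps by blast
qed

end
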